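(* For every $n\ge2$, \[\max_{\pi\in S_n}|\operatorname{SC}_{213}^{-1}(\pi)|=\max_{\pi\in S_n}|\operatorname{SC}_{231}^{-1}(\pi)|=2^{n-2}.\]
   Context: $S_n$ is the set of permutations of $[n]$ in one-line notation. Two sequences of distinct integers have the same relative order if replacing the $i$th smallest entry of each by $i$ yields the same word; a sequence avoids $\sigma$ consecutively if no consecutive subsequence has the same relative order as $\sigma$. For $\sigma\in\{213,231\}$, $\operatorname{SC}_\sigma:S_n\to S_n$ sends a permutation through a stack: at each step, if there is a next input entry and placing it on top of the stack would make the stack contents, read top to bottom, avoid $\sigma$ consecutively, push it; otherwise pop the top entry of the stack to the end of the output; stop when the output has length $n$. *)

theory Defs
  imports Main "HOL-Library.Sublist" "HOL-Combinatorics.Multiset_Permutations"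
begin

abbreviation perms :: "nat \<Rightarrow> nat list set" where
  "perms n \<equiv> permutations_of_set {1..n}"

definition standardize :: "nat list \<Rightarrow> nat list" where
  "standardize w = map (\<lambda>x. card {y \<in> set w. y \<le> x}) w"

definition same_relative_order :: "nat list \<Rightarrow> nat list \<Rightarrow> bool" where
  "same_relative_order u v \<longleftrightarrow> standardize u = standardize v"

(* sublist of HOL-Library.Sublist is contiguous, as required for consecutive patterns. *)
definition avoids_consecutively :: "nat list \<Rightarrow> nat list \<Rightarrow> bool" where
  "avoids_consecutively \<sigma> w \<longleftrightarrow> (\<nexists>u. sublist u w \<and> same_relative_order u \<sigma>)"

(* Arguments: pattern, remaining input, stack (top first), output. For patterns of length at
   least 2 an entry can always be pushed on the empty stack, so the run stops exactly when the
   input and the stack are both empty, i.e. when all entries are in the output. *)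
function stack_run :: "nat list \<Rightarrow> nat list \<Rightarrow> nat list \<Rightarrow> nat list \<Rightarrow> nat list" where
  "stack_run \<sigma> inp st out =
     (if inp \<noteq> [] \<and> avoids_consecutively \<sigma> (hd inp # st)
      then stack_run \<sigma> (tl inp) (hd inp # st) out
      else case st of
             [] \<Rightarrow> out
           | y # st' \<Rightarrow> stack_run \<sigma> inp st' (out @ [y]))"
  by pat_completeness auto
termination
proof (relation "measure (\<lambda>(\<sigma>, inp, st, out). 2 * length inp + length st)", goal_cases)
  case (2 \<sigma> inp st out)
  then show ?case by (cases inp) auto
qed auto

declare stack_run.simps [simp del]

definition SC :: "nat list \<Rightarrow> nat list \<Rightarrow> nat list" where
  "SC \<sigma> \<pi> = stack_run \<sigma> \<pi> [] []"

definition SC_preimage :: "nat list \<Rightarrow> nat \<Rightarrow> nat list \<Rightarrow> nat list set" where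
  "SC_preimage \<sigma> n \<pi> = {\<tau> \<in> perms n. SC \<sigma> \<tau> = \<pi>}"

lemma avoids_consecutively_singleton:
  assumes "length \<sigma> \<ge> 2"
  shows "avoids_consecutively \<sigma> [x]"
proof -
  have "False" if "sublist u [x]" "standardize u = standardize \<sigma>" for u
  proof -
    have "length u \<le> 1" using sublist_length_le[OF that(1)] by simp
    moreover have "length u = length \<sigma>"
      using arg_cong[OF that(2), of length] by (simp add: standardize_def)
    ultimately show False using assms by simp
  qed
  then show ?thesis by (auto simp: avoids_consecutively_def same_relative_order_def)
qed

lemma mset_stack_run:
  assumes "length \<sigma> \<ge> 2"
  shows "mset (stack_run \<sigma> inp st out) = mset inp + mset st + mset out"
  using assms
proof (induction \<sigma> inp st out rule: stack_run.induct)
  case (1 \<sigma> inp st out)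
  show ?case
  proof (cases "inp \<noteq> [] \<and> avoids_consecutively \<sigma> (hd inp # st)")
    case True
    then show ?thesis using "1.IH"(1) "1.prems"
      by (subst stack_run.simps) (cases inp; simp)
  next
    case False
    show ?thesis
    proof (cases st)
      case Nil
      then have "inp = []"
        using False avoids_consecutively_singleton[OF "1.prems"] by auto
      then show ?thesis using Nil by (subst stack_run.simps) simp
    next
      case (Cons y st')
      have "stack_run \<sigma> inp st out = stack_run \<sigma> inp st' (out @ [y])"
        using False Cons by (subst stack_run.simps) auto
      then show ?thesis using "1.IH"(2)[OF False Cons "1.prems"] Cons by simp
    qed
  qed
qed

lemma SC_in_perms:
  assumes "length \<sigma> \<ge> 2" and "\<pi> \<in> perms n"
  shows "SC \<sigma> \<pi> \<in> perms n"
proof -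
  have m: "mset (SC \<sigma> \<pi>) = mset \<pi>"
    using mset_stack_run[OF assms(1)] by (simp add: SC_def)
  show ?thesis
    using assms(2) mset_eq_setD[OF m] mset_eq_imp_distinct_iff[OF m]
    by (simp add: permutations_of_set_def)
qed

end

theory Submission
  imports Defs
begin

text \<open>
  Write \<open>R\<close> for \<open><\<close> if the pattern is 231 and for \<open>>\<close> if it is 213. An entry \<open>x\<close> cannot be pushed
  on a stack with top entries \<open>a\<close>, \<open>b\<close> exactly when \<open>R b x\<close> and \<open>R x a\<close>, and then popping \<open>a\<close> alone
  makes room for \<open>x\<close>. So each input entry is either pushed or replaces the top of the stack. The
  number of replacements tells where the output popped early ends and the final stack begins, hence
  the image and the sequence of moves together determine the input by running backwards. The first
  two moves are pushes, which bounds every fibre by $2^{n-2}$. Over the permutation that is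
  monotone for \<open>R\<close>, running backwards never gets stuck, so there every sequence of moves occurs.
\<close>

section \<open>Pushes and replacements\<close>

definition blocked :: "(nat \<Rightarrow> nat \<Rightarrow> bool) \<Rightarrow> nat \<Rightarrow> nat list \<Rightarrow> bool" where
  "blocked R x st \<longleftrightarrow> (\<exists>a b st'. st = a # b # st' \<and> R b x \<and> R x a)"

lemma blocked_simps [simp]:
  "\<not> blocked R x []"
  "\<not> blocked R x [a]"
  "blocked R x (a # b # st) \<longleftrightarrow> R b x \<and> R x a"
  by (auto simp: blocked_def)

text \<open>The input is processed from right to left in \<open>state\<close> and \<open>moves\<close>, so that the last entry read
  by the stack is the head of the list. A state consists of the output and the stack.\<close>

fun state :: "(nat \<Rightarrow> nat \<Rightarrow> bool) \<Rightarrow> nat list \<Rightarrow> nat list \<times> nat list" where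
  "state R [] = ([], [])"
| "state R (x # w) = (case state R w of (out, st) \<Rightarrow>
     if blocked R x st then (out @ [hd st], x # tl st) else (out, x # st))"

fun moves :: "(nat \<Rightarrow> nat \<Rightarrow> bool) \<Rightarrow> nat list \<Rightarrow> bool list" where
  "moves R [] = []"
| "moves R (x # w) = blocked R x (snd (state R w)) # moves R w"

lemma length_moves [simp]: "length (moves R w) = length w"
  by (induction w) auto

text \<open>Only a replacement pops, and it pops a single entry. Hence the moves alone tell where
  \<open>out @ st\<close> is to be cut.\<close>

lemma length_fst_state: "length (fst (state R w)) = count_list (moves R w) True"
  by (induction w) (auto split: prod.splits)

text \<open>The last move can be undone: the top of the stack is the entry read last, and after a
  replacement the former top is the last entry of the output.\<close>

lemma state_moves_inj:
  assumes "state R w = state R w'" "moves R w = moves R w'"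
  shows "w = w'"
  using assms
proof (induction w arbitrary: w')
  case Nil
  then show ?case by (cases w') auto
next
  case (Cons x w)
  obtain x' v where w': "w' = x' # v"
    using Cons.prems(2) by (cases w') auto
  have mv: "moves R w = moves R v"
    and bl: "blocked R x (snd (state R w)) = blocked R x' (snd (state R v))"
    using Cons.prems(2) w' by auto
  \<comment> \<open>Unfolding \<open>blocked_def\<close> shows the old stack to be nonempty after a
    replacement, so that \<open>hd\<close> and \<open>tl\<close> determine it.\<close>
  have "x = x' \<and> state R w = state R v"
    using Cons.prems(1) bl unfolding w'
    by (auto split: prod.splits if_splits simp: blocked_def)
  then show ?case using Cons.IH mv w' by blast
qed

lemma append_state_moves_inj:
  assumes "fst (state R w) @ snd (state R w) = fst (state R w') @ snd (state R w')"
    and "moves R w = moves R w'"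
  shows "w = w'"
proof (rule state_moves_inj[OF _ assms(2)])
  have "length (fst (state R w)) = length (fst (state R w'))"
    by (simp add: length_fst_state assms(2))
  then show "state R w = state R w'"
    using assms(1) by (simp add: prod_eq_iff)
qed

text \<open>Blocking takes two stack entries, and the first two entries read meet stacks of size 0
  and 1. Their moves come last because words are read from the right.\<close>

lemma moves_eq_append_False:
  assumes "length w = k + 2"
  shows "\<exists>bs. length bs = k \<and> moves R w = bs @ [False, False]"
  using assms
proof (induction k arbitrary: w)
  case 0
  then obtain x y where "w = [x, y]"
    by (auto simp: length_Suc_conv numeral_2_eq_2)
  then show ?case by simp
next
  case (Suc k)
  then obtain x v where w: "w = x # v" "length v = k + 2"
    by (cases w) auto
  then obtain bs where "length bs = k" "moves R v = bs @ [False, False]"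
    using Suc.IH by blast
  then show ?case
    using w by (intro exI[of _ "blocked R x (snd (state R v)) # bs"]) simp
qed

text \<open>Undoing either move deletes the stack top \<open>x\<close> from \<open>out @ st\<close>,
  so sortedness survives and the induction goes on. The summand 2 accounts for the two initial
  pushes.\<close>

lemma ex_moves_of_sorted:
  assumes "asymp R"
    and "sorted_wrt (\<lambda>a b. R b a) (out @ st)"
    and "length out = count_list bs True" "length st = count_list bs False + 2"
  shows "\<exists>w. state R w = (out, st) \<and> moves R w = bs @ [False, False]"
  using assms(2-)
proof (induction bs arbitrary: out st)
  case Nil
  then obtain x y where "out = []" "st = [x, y]"
    by (auto simp: length_Suc_conv numeral_2_eq_2)
  then show ?case by (intro exI[of _ "[x, y]"]) simp
next
  case (Cons c bs)
  obtain x b st' where st: "st = x # b # st'"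
    using Cons.prems(3) by (cases st; cases "tl st") (auto split: if_splits)
  show ?case
  proof (cases c)
    case True
    then obtain out' a where out: "out = out' @ [a]"
      using Cons.prems(2) by (cases out rule: rev_cases) auto
    have "sorted_wrt (\<lambda>a b. R b a) (out' @ a # b # st')"
      using Cons.prems(1) by (auto simp: out st sorted_wrt_append)
    then obtain w where "state R w = (out', a # b # st')" "moves R w = bs @ [False, False]"
      using Cons.IH[of out' "a # b # st'"] Cons.prems(2,3) True out st by auto
    moreover have "R b x" "R x a"
      using Cons.prems(1) by (auto simp: out st sorted_wrt_append)
    ultimately show ?thesis
      using True out st by (intro exI[of _ "x # w"]) simp
  next
    case False
    have "sorted_wrt (\<lambda>a b. R b a) (out @ b # st')"
      using Cons.prems(1) by (auto simp: st sorted_wrt_append)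
    then obtain w where "state R w = (out, b # st')" "moves R w = bs @ [False, False]"
      using Cons.IH[of out "b # st'"] Cons.prems(2,3) False st by auto
    \<comment> \<open>Sortedness gives \<open>R b x\<close>, which by asymmetry rules out the
      condition \<open>R x b\<close> for blocking.\<close>
    moreover have "\<not> blocked R x (b # st')"
      using Cons.prems(1) \<open>asymp R\<close> by (auto simp: st sorted_wrt_append blocked_def dest: asympD)
    ultimately show ?thesis
      using False st by (intro exI[of _ "x # w"]) simp
  qed
qed

section \<open>From patterns to the relation \<open>R\<close>\<close>

text \<open>This treats both patterns at once. Here \<open>x\<close> is the new entry above the top
  entries \<open>a\<close> and \<open>b\<close>.\<close>

definition encodes_pattern :: "(nat \<Rightarrow> nat \<Rightarrow> bool) \<Rightarrow> nat list \<Rightarrow> bool" where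
  "encodes_pattern R \<sigma> \<longleftrightarrow> length \<sigma> = 3 \<and> asymp R \<and>
     (\<forall>x a b. same_relative_order [x, a, b] \<sigma> \<longleftrightarrow> R b x \<and> R x a)"

text \<open>With the sets written through \<open>filter\<close>, simplification can compute the
  ranks once the order of the entries is fixed.\<close>

lemma standardize_three:
  "standardize [x, a, b] =
     [card (set (filter (\<lambda>y. y \<le> x) [x, a, b])), card (set (filter (\<lambda>y. y \<le> a) [x, a, b])),
      card (set (filter (\<lambda>y. y \<le> b) [x, a, b]))]"
  by (simp only: standardize_def set_filter list.map)

lemma encodes_pattern_231: "encodes_pattern (<) [2, 3, 1]"
proof -
  have "same_relative_order [x, a, b] [2, 3, 1] \<longleftrightarrow> b < x \<and> x < a" for x a b
    unfolding same_relative_order_def standardize_three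
    by (cases x a rule: linorder_cases; cases x b rule: linorder_cases;
        cases a b rule: linorder_cases) (simp_all add: card_insert_if)
  then show ?thesis by (simp add: encodes_pattern_def)
qed

lemma encodes_pattern_213: "encodes_pattern (>) [2, 1, 3]"
proof -
  have "same_relative_order [x, a, b] [2, 1, 3] \<longleftrightarrow> b > x \<and> x > a" for x a b
    unfolding same_relative_order_def standardize_three
    by (cases x a rule: linorder_cases; cases x b rule: linorder_cases;
        cases a b rule: linorder_cases) (simp_all add: card_insert_if)
  then show ?thesis by (simp add: encodes_pattern_def)
qed

text \<open>A new occurrence must contain the new top, so it is a prefix of length 3.\<close>

lemma avoids_consecutively_Cons:
  assumes "encodes_pattern R \<sigma>"
  shows "avoids_consecutively \<sigma> (x # st) \<longleftrightarrow> avoids_consecutively \<sigma> st \<and> \<not> blocked R x st"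
proof -
  have "\<exists>y a b. u = [y, a, b]" if "same_relative_order u \<sigma>" for u
  proof -
    have "length u = 3"
      using arg_cong[OF that[unfolded same_relative_order_def], of length] assms
      by (simp add: standardize_def encodes_pattern_def)
    then show ?thesis by (auto simp: length_Suc_conv numeral_3_eq_3)
  qed
  then have "(\<exists>u. prefix u (x # st) \<and> same_relative_order u \<sigma>) \<longleftrightarrow>
      (\<exists>y a b. prefix [y, a, b] (x # st) \<and> same_relative_order [y, a, b] \<sigma>)"
    by blast
  also have "\<dots> \<longleftrightarrow> blocked R x st"
    using assms by (auto simp: encodes_pattern_def blocked_def prefix_def)
  finally show ?thesis
    by (auto simp: avoids_consecutively_def sublist_Cons_right)
qed

lemma avoids_consecutively_Nil:
  assumes "encodes_pattern R \<sigma>"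
  shows "avoids_consecutively \<sigma> []"
  using avoids_consecutively_singleton[of \<sigma> 0] avoids_consecutively_Cons[OF assms, of 0 "[]"] assms
  by (simp add: encodes_pattern_def)

lemma stack_run_Nil: "stack_run \<sigma> [] st out = out @ st"
proof (induction st arbitrary: out)
  case Nil
  show ?case by (subst stack_run.simps) simp
next
  case (Cons y st)
  then show ?case by (subst stack_run.simps) simp
qed

text \<open>Here \<open>w\<close> is the input already read, reversed. One replacement in
  \<open>state\<close> is a pop followed by a push in \<open>stack_run\<close>.\<close>

lemma stack_run_state:
  assumes "encodes_pattern R \<sigma>" "state R w = (out, st)" "avoids_consecutively \<sigma> st"
  shows "stack_run \<sigma> inp st out = fst (state R (rev inp @ w)) @ snd (state R (rev inp @ w))"
  using assms(2,3)
proof (induction inp arbitrary: w out st)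
  case Nil
  then show ?case by (simp add: stack_run_Nil)
next
  case (Cons x inp)
  note avoids_Cons = avoids_consecutively_Cons[OF assms(1)]
  show ?case
  proof (cases "blocked R x st")
    case False
    then have "avoids_consecutively \<sigma> (x # st)"
      using Cons.prems avoids_Cons by blast
    then show ?thesis
      using Cons.IH[of "x # w" out "x # st"] Cons.prems False by (simp add: stack_run.simps)
  next
    case True
    then obtain a b st' where st: "st = a # b # st'" and R: "R b x" "R x a"
      by (auto simp: blocked_def)
    have "\<not> avoids_consecutively \<sigma> (x # st)"
      using True avoids_Cons by blast
    then have pop: "stack_run \<sigma> (x # inp) st out = stack_run \<sigma> (x # inp) (b # st') (out @ [a])"
      by (subst stack_run.simps) (simp add: st)
    \<comment> \<open>One pop suffices: \<open>R b x\<close> excludes \<open>R x b\<close>, so the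
      new top \<open>b\<close> cannot block \<open>x\<close>.\<close>
    have "\<not> blocked R x (b # st')"
      using R assms(1) by (auto simp: blocked_def encodes_pattern_def dest: asympD)
    then have av: "avoids_consecutively \<sigma> (x # b # st')"
      using Cons.prems(2) avoids_Cons st by blast
    then have "stack_run \<sigma> (x # inp) (b # st') (out @ [a])
        = stack_run \<sigma> inp (x # b # st') (out @ [a])"
      by (subst stack_run.simps) simp
    also have "\<dots> = fst (state R (rev inp @ x # w)) @ snd (state R (rev inp @ x # w))"
      using Cons.prems(1) True st by (intro Cons.IH av) simp
    finally show ?thesis using pop by simp
  qed
qed

lemma SC_eq_state:
  assumes "encodes_pattern R \<sigma>"
  shows "SC \<sigma> \<tau> = fst (state R (rev \<tau>)) @ snd (state R (rev \<tau>))"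
  using stack_run_state[OF assms, of "[]" "[]" "[]" \<tau>] avoids_consecutively_Nil[OF assms]
  by (simp add: SC_def)

section \<open>Counting fibres by move words\<close>

lemma inj_on_moves_SC_preimage:
  assumes "encodes_pattern R \<sigma>"
  shows "inj_on (\<lambda>\<tau>. moves R (rev \<tau>)) (SC_preimage \<sigma> n \<pi>)"
proof (rule inj_onI)
  fix \<tau> \<tau>'
  assume "\<tau> \<in> SC_preimage \<sigma> n \<pi>" "\<tau>' \<in> SC_preimage \<sigma> n \<pi>"
    and moves: "moves R (rev \<tau>) = moves R (rev \<tau>')"
  then have "SC \<sigma> \<tau> = SC \<sigma> \<tau>'"
    by (simp add: SC_preimage_def)
  then have "rev \<tau> = rev \<tau>'"
    unfolding SC_eq_state[OF assms] using moves by (rule append_state_moves_inj)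
  then show "\<tau> = \<tau>'" by simp
qed

definition move_words :: "nat \<Rightarrow> bool list set" where
  "move_words k = (\<lambda>bs. bs @ [False, False]) ` {bs. length bs = k}"

lemma finite_move_words: "finite (move_words k)"
  using finite_lists_length_eq[of "UNIV :: bool set" k] by (simp add: move_words_def)

lemma card_move_words: "card (move_words k) = 2 ^ k"
  using card_lists_length_eq[of "UNIV :: bool set" k]
  by (simp add: move_words_def card_image inj_on_def)

lemma moves_SC_preimage_subset:
  assumes "n \<ge> 2"
  shows "(\<lambda>\<tau>. moves R (rev \<tau>)) ` SC_preimage \<sigma> n \<pi> \<subseteq> move_words (n - 2)"
proof
  fix m assume "m \<in> (\<lambda>\<tau>. moves R (rev \<tau>)) ` SC_preimage \<sigma> n \<pi>"
  then obtain \<tau> where "m = moves R (rev \<tau>)" "\<tau> \<in> perms n"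
    by (auto simp: SC_preimage_def)
  moreover from this have "length (rev \<tau>) = (n - 2) + 2"
    using assms length_finite_permutations_of_set by fastforce
  ultimately show "m \<in> move_words (n - 2)"
    using moves_eq_append_False[of "rev \<tau>" "n - 2" R] by (auto simp: move_words_def)
qed

lemma card_SC_preimage_le:
  assumes "encodes_pattern R \<sigma>" "n \<ge> 2"
  shows "card (SC_preimage \<sigma> n \<pi>) \<le> 2 ^ (n - 2)"
  using card_inj_on_le[OF inj_on_moves_SC_preimage[OF assms(1)]
      moves_SC_preimage_subset[OF assms(2)] finite_move_words]
  by (simp add: card_move_words)

lemma move_words_subset_moves_SC_preimage:
  assumes "encodes_pattern R \<sigma>" "n \<ge> 2"
    and \<pi>: "\<pi> \<in> perms n" "sorted_wrt (\<lambda>a b. R b a) \<pi>"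
  shows "move_words (n - 2) \<subseteq> (\<lambda>\<tau>. moves R (rev \<tau>)) ` SC_preimage \<sigma> n \<pi>"
proof
  fix m assume "m \<in> move_words (n - 2)"
  then obtain bs where m: "m = bs @ [False, False]" and bs: "length bs = n - 2"
    by (auto simp: move_words_def)
  \<comment> \<open>The cut of \<open>\<pi>\<close> between the entries popped early and the final
    stack.\<close>
  define k where "k = count_list bs True"
  have count: "count_list bs True + count_list bs False = length bs"
    by (induction bs) auto
  have "length \<pi> = n"
    using \<pi>(1) length_finite_permutations_of_set by fastforce
  then have "\<exists>w. state R w = (take k \<pi>, drop k \<pi>) \<and> moves R w = m"
    unfolding m using assms count bs
    by (intro ex_moves_of_sorted) (auto simp: k_def encodes_pattern_def)
  then obtain w where w: "state R w = (take k \<pi>, drop k \<pi>)" "moves R w = m"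
    by blast
  then have SC: "SC \<sigma> (rev w) = \<pi>"
    by (simp add: SC_eq_state[OF assms(1)])
  \<comment> \<open>The backward construction does not record which entries \<open>w\<close> has;
    since a run only rearranges its input, they are those of \<open>\<pi>\<close>.\<close>
  have "mset (SC \<sigma> (rev w)) = mset (rev w)"
    using mset_stack_run[of \<sigma> "rev w" "[]" "[]"] assms(1)
    by (simp add: SC_def encodes_pattern_def)
  then have mset: "mset (rev w) = mset \<pi>"
    using SC by simp
  have "rev w \<in> perms n"
    using \<pi>(1) mset_eq_setD[OF mset] mset_eq_imp_distinct_iff[OF mset]
    by (simp add: permutations_of_set_def)
  then show "m \<in> (\<lambda>\<tau>. moves R (rev \<tau>)) ` SC_preimage \<sigma> n \<pi>"
    using SC w(2) by (intro image_eqI[of _ _ "rev w"]) (auto simp: SC_preimage_def)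
qed

lemma Max_card_SC_preimage:
  assumes "encodes_pattern R \<sigma>" "n \<ge> 2"
    and "\<pi> \<in> perms n" "sorted_wrt (\<lambda>a b. R b a) \<pi>"
  shows "Max ((\<lambda>\<pi>. card (SC_preimage \<sigma> n \<pi>)) ` perms n) = 2 ^ (n - 2)"
proof (rule Max_eqI)
  have "(\<lambda>\<tau>. moves R (rev \<tau>)) ` SC_preimage \<sigma> n \<pi> = move_words (n - 2)"
    using moves_SC_preimage_subset[OF assms(2)] move_words_subset_moves_SC_preimage[OF assms]
    by (rule subset_antisym)
  then have "card (SC_preimage \<sigma> n \<pi>) = 2 ^ (n - 2)"
    using card_image[OF inj_on_moves_SC_preimage[OF assms(1)], of n \<pi>]
    by (simp add: card_move_words)
  then show "2 ^ (n - 2) \<in> (\<lambda>\<pi>. card (SC_preimage \<sigma> n \<pi>)) ` perms n"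
    using assms(3) by (metis imageI)
qed (use card_SC_preimage_le[OF assms(1,2)] in auto)

theorem theorem5p2:
  fixes n :: nat
  assumes "n \<ge> 2"
  shows "Max ((\<lambda>\<pi>. card (SC_preimage [2, 1, 3] n \<pi>)) ` perms n) = 2 ^ (n - 2)
       \<and> Max ((\<lambda>\<pi>. card (SC_preimage [2, 3, 1] n \<pi>)) ` perms n) = 2 ^ (n - 2)"
proof
  \<comment> \<open>The order required of \<open>\<pi>\<close> is the converse of \<open>R\<close>:
    increasing for 213, where \<open>R\<close> is \<open>>\<close>, and decreasing for 231.\<close>
  have up: "[1..<Suc n] \<in> perms n" "sorted_wrt (<) [1..<Suc n]"
    by (simp_all add: permutations_of_set_def atLeastLessThanSuc_atLeastAtMost del: upt_Suc)
  then have down: "rev [1..<Suc n] \<in> perms n" "sorted_wrt (\<lambda>a b. b < a) (rev [1..<Suc n])"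
    by (simp_all only: permutations_of_set_def sorted_wrt_rev mem_Collect_eq set_rev distinct_rev)
  show "Max ((\<lambda>\<pi>. card (SC_preimage [2, 1, 3] n \<pi>)) ` perms n) = 2 ^ (n - 2)"
    using up by (rule Max_card_SC_preimage[OF encodes_pattern_213 assms])
  show "Max ((\<lambda>\<pi>. card (SC_preimage [2, 3, 1] n \<pi>)) ` perms n) = 2 ^ (n - 2)"
    using down by (rule Max_card_SC_preimage[OF encodes_pattern_231 assms])
qed

end
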